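(* If $N$ is a nilpotent subgroup of $\mathrm{Diff}^2(\mathbf{R})$ and every element of $N$ has a fixed point in $\mathbf{R}$, then $N$ is abelian.
   Context: $\mathrm{Diff}^{2}(\mathbf{R})$ denotes the group of orientation-preserving $C^2$ diffeomorphisms of the real line, under composition. *)

theory Defs
  imports "HOL-Analysis.Analysis" "HOL-Algebra.Generated_Groups"
begin

definition C2_real :: "(real \<Rightarrow> real) \<Rightarrow> bool" where
  "C2_real f \<longleftrightarrow> f differentiable_on UNIV \<and> deriv f C1_differentiable_on UNIV"

definition Diff2_R :: "(real \<Rightarrow> real) monoid" where
  "Diff2_R =
     \<lparr>carrier = {f. bij f \<and> C2_real f \<and> C2_real (inv_into UNIV f) \<and> (\<forall>x. 0 < deriv f x)},
      mult = (\<circ>),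
      one = id\<rparr>"

text \<open>The lower central series, starting with the whole group at index 0, so that the
  trivial group is nilpotent of class 0 and abelian groups are nilpotent of class at most 1.\<close>

primrec lower_central :: "('a, 'b) monoid_scheme \<Rightarrow> nat \<Rightarrow> 'a set" where
  "lower_central G 0 = carrier G"
| "lower_central G (Suc n) =
     generate G (\<Union>x \<in> carrier G. \<Union>y \<in> lower_central G n.
       {x \<otimes>\<^bsub>G\<^esub> y \<otimes>\<^bsub>G\<^esub> inv\<^bsub>G\<^esub> x \<otimes>\<^bsub>G\<^esub> inv\<^bsub>G\<^esub> y})"

definition nilpotent_group :: "('a, 'b) monoid_scheme \<Rightarrow> bool" where
  "nilpotent_group G \<longleftrightarrow> group G \<and> (\<exists>n. lower_central G n = {\<one>\<^bsub>G\<^esub>})"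

lemma C2_real_DERIV:
  assumes "C2_real f" shows "(f has_real_derivative deriv f x) (at x)"
  using assms DERIV_deriv_iff_real_differentiable[of f x]
  by (simp add: C2_real_def differentiable_on_def)

lemma C2_real_id: "C2_real id"
proof -
  have "deriv id = (\<lambda>x::real. 1)"
    by (rule ext) (simp add: id_def)
  then show ?thesis
    by (simp add: C2_real_def id_def)
qed

lemma deriv_compose_C2:
  assumes "C2_real f" "C2_real g"
  shows "((f \<circ> g) has_real_derivative deriv f (g x) * deriv g x) (at x)"
  using DERIV_chain[OF C2_real_DERIV[OF assms(1)] C2_real_DERIV[OF assms(2)]] .

lemma C2_real_compose:
  assumes f: "C2_real f" and g: "C2_real g"
  shows "C2_real (f \<circ> g)"
proof -
  have d: "(h has_real_derivative deriv h x) (at x)" "isCont (deriv (deriv h)) x"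
    "(deriv h has_real_derivative deriv (deriv h) x) (at x)" if h: "C2_real h" for h x
  proof -
    show "(h has_real_derivative deriv h x) (at x)" by (rule C2_real_DERIV[OF h])
    obtain D where D: "\<And>x. (deriv h has_real_derivative D x) (at x)" "continuous_on UNIV D"
      using h unfolding C2_real_def C1_differentiable_on_def
        has_real_derivative_iff_has_vector_derivative by blast
    have "deriv (deriv h) = D" by (rule ext, rule DERIV_imp_deriv, rule D(1))
    with D show "isCont (deriv (deriv h)) x"
      "(deriv h has_real_derivative deriv (deriv h) x) (at x)"
      by (simp_all add: continuous_on_eq_continuous_at)
  qed
  have e: "deriv (f \<circ> g) = (\<lambda>x. deriv f (g x) * deriv g x)"
    by (rule ext, rule DERIV_imp_deriv, rule deriv_compose_C2[OF f g])
  let ?D = "\<lambda>x. deriv f (g x) * deriv (deriv g) x + (deriv (deriv f) (g x) * deriv g x) * deriv g x"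
  have D: "(deriv (f \<circ> g) has_real_derivative ?D x) (at x)" for x
    unfolding e
    by (rule DERIV_mult'[OF DERIV_chain2[OF d(3)[OF f] d(1)[OF g]] d(3)[OF g]])
  have "isCont ?D x" for x
  proof -
    have "isCont g x" "isCont (deriv g) x" "isCont (deriv f) (g x)"
      by (rule DERIV_isCont[OF d(1)[OF g]] DERIV_isCont[OF d(3)[OF g]] DERIV_isCont[OF d(3)[OF f]])+
    moreover have "isCont (deriv (deriv g)) x" "isCont (deriv (deriv f)) (g x)"
      by (rule d(2)[OF g], rule d(2)[OF f])
    ultimately show ?thesis
      using isCont_o2[of x g "deriv f"] isCont_o2[of x g "deriv (deriv f)"]
      by (intro continuous_add continuous_mult) blast+
  qed
  then have "continuous_on UNIV ?D"
    by (simp add: continuous_on_eq_continuous_at)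
  with D have "deriv (f \<circ> g) C1_differentiable_on UNIV"
    unfolding C1_differentiable_on_def has_real_derivative_iff_has_vector_derivative
    by (intro exI[of _ ?D] conjI ballI)
  moreover have "(f \<circ> g) differentiable_on UNIV"
    using deriv_compose_C2[OF f g] unfolding differentiable_on_def real_differentiable_def
    by blast
  ultimately show ?thesis by (simp add: C2_real_def)
qed

lemma group_Diff2_R: "group Diff2_R"
proof (rule groupI)
  fix f g assume "f \<in> carrier Diff2_R" "g \<in> carrier Diff2_R"
  then have f: "bij f" "C2_real f" "C2_real (inv_into UNIV f)" "\<And>x. 0 < deriv f x"
    and g: "bij g" "C2_real g" "C2_real (inv_into UNIV g)" "\<And>x. 0 < deriv g x"
    by (auto simp: Diff2_R_def)
  have "deriv (f \<circ> g) x = deriv f (g x) * deriv g x" for x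
    by (rule DERIV_imp_deriv, rule deriv_compose_C2[OF f(2) g(2)])
  then show "f \<otimes>\<^bsub>Diff2_R\<^esub> g \<in> carrier Diff2_R"
    using f g by (auto simp: Diff2_R_def bij_comp C2_real_compose o_inv_distrib)
next
  show "\<one>\<^bsub>Diff2_R\<^esub> \<in> carrier Diff2_R"
    using C2_real_id by (simp add: Diff2_R_def)
next
  fix f assume "f \<in> carrier Diff2_R"
  then have f: "bij f" "C2_real f" "C2_real (inv_into UNIV f)" "\<And>x. 0 < deriv f x"
    by (auto simp: Diff2_R_def)
  let ?g = "inv_into UNIV f"
  have fg: "f \<circ> ?g = id" using bij_is_surj[OF f(1)] surj_iff by blast
  have "0 < deriv ?g x" for x
  proof -
    have "(id has_real_derivative deriv f (?g x) * deriv ?g x) (at x)"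
      using deriv_compose_C2[OF f(2,3)] by (simp add: fg)
    then have "deriv f (?g x) * deriv ?g x = 1"
      by (rule DERIV_unique) (simp add: id_def)
    then show ?thesis using f(4)[of "?g x"]
      using zero_less_mult_pos[of "deriv f (?g x)" "deriv ?g x"] by simp
  qed
  then have "?g \<in> carrier Diff2_R"
    using f by (simp add: Diff2_R_def bij_imp_bij_inv inv_inv_eq)
  moreover have "?g \<otimes>\<^bsub>Diff2_R\<^esub> f = \<one>\<^bsub>Diff2_R\<^esub>"
    using f(1) by (simp add: Diff2_R_def bij_is_inj)
  ultimately show "\<exists>g\<in>carrier Diff2_R. g \<otimes>\<^bsub>Diff2_R\<^esub> f = \<one>\<^bsub>Diff2_R\<^esub>" by blast
qed (simp_all add: Diff2_R_def comp_assoc)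

end

theory Submission
  imports Defs
begin

text \<open>A non-abelian nilpotent group contains a nontrivial central commutator $h = [f, g]$. Since
  $h$ has a fixed point, some interval $I$ without fixed points of $h$ has an endpoint $a$ fixed
  by $h$. Kopell's distortion argument, which uses that $f$ and $g$ are $C^2$ and have fixed points,
  shows that $f$ and $g$ fix $a$, hence preserve $I$. On $I$ every displacement is bounded by a power
  of $h$, so $f^p$ and $g^p$ move points by at most $O(p)$ powers of $h$; this contradicts
  $f^p g^p = h^{p^2} g^p f^p$.\<close>

section \<open>Central commutators in nilpotent groups\<close>

lemma (in group) lower_central_subset: "lower_central G n \<subseteq> carrier G"
proof (induction n)
  case (Suc n)
  then show ?case
    by (auto intro!: generate_incl)
qed simp

text \<open>The last nontrivial term of the lower central series is central, because its commutators
  lie in the trivial next term. Non-commutativity puts its index at 1 or above, so that it is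
  generated by commutators, one of them nontrivial.\<close>

lemma (in group) nilpotent_central_commutator:
  assumes nil: "nilpotent_group G" and nc: "\<not> comm_group G"
  obtains x y where "x \<in> carrier G" "y \<in> carrier G"
    "x \<otimes> y \<otimes> inv x \<otimes> inv y \<noteq> \<one>"
    "\<And>z. z \<in> carrier G \<Longrightarrow>
      z \<otimes> (x \<otimes> y \<otimes> inv x \<otimes> inv y) = (x \<otimes> y \<otimes> inv x \<otimes> inv y) \<otimes> z"
proof -
  have comm: "x \<otimes> y = y \<otimes> x"
    if "x \<in> carrier G" "y \<in> carrier G" "x \<otimes> y \<otimes> inv x \<otimes> inv y = \<one>" for x y
    using that by (metis inv_closed inv_equality inv_inv inv_solve_right m_closed)
  have inS: "x \<otimes> y \<otimes> inv x \<otimes> inv y \<in> lower_central G (Suc n)"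
    if "x \<in> carrier G" "y \<in> lower_central G n" for x y n
    unfolding lower_central.simps by (rule generate.incl) (use that in blast)
  define n where "n = (LEAST n. lower_central G n = {\<one>})"
  have n: "lower_central G n = {\<one>}"
    unfolding n_def using nil LeastI_ex unfolding nilpotent_group_def by (metis (mono_tags, lifting))
  have min: "lower_central G k \<noteq> {\<one>}" if "k < n" for k
    using that not_less_Least unfolding n_def by blast
  obtain x0 y0 where xy0: "x0 \<in> carrier G" "y0 \<in> carrier G" "x0 \<otimes> y0 \<noteq> y0 \<otimes> x0"
    using nc group_comm_groupI by blast
  have "n \<noteq> 0"
    using xy0 n by (metis lower_central.simps(1) singletonD)
  moreover have "n \<noteq> Suc 0"
  proof
    assume "n = Suc 0"
    then have "x0 \<otimes> y0 \<otimes> inv x0 \<otimes> inv y0 \<in> {\<one>}"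
      using inS[of x0 y0 0] xy0 n by (metis lower_central.simps(1))
    then show False using comm[OF xy0(1,2)] xy0(3) by blast
  qed
  ultimately obtain m where m: "n = Suc (Suc m)"
    by (metis not0_implies_Suc)
  \<comment> \<open>If all these commutators were trivial, the term at \<open>Suc m\<close> would
    already be trivial, against the minimality of \<open>n\<close>.\<close>
  have "\<exists>x\<in>carrier G. \<exists>y\<in>lower_central G m. x \<otimes> y \<otimes> inv x \<otimes> inv y \<noteq> \<one>"
  proof (rule ccontr)
    assume "\<not> ?thesis"
    then have "lower_central G (Suc m) \<subseteq> generate G {\<one>}"
      unfolding lower_central.simps by (intro mono_generate) auto
    then have "lower_central G (Suc m) = {\<one>}"
      using generate.one[of G] by (auto simp: generate_one)
    then show False using min m by blast
  qed
  then obtain x y where xy: "x \<in> carrier G" "y \<in> lower_central G m"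
    "x \<otimes> y \<otimes> inv x \<otimes> inv y \<noteq> \<one>" by blast
  show thesis
  proof (rule that[OF xy(1) _ xy(3)])
    show y: "y \<in> carrier G" using xy lower_central_subset by blast
    fix z assume z: "z \<in> carrier G"
    show "z \<otimes> (x \<otimes> y \<otimes> inv x \<otimes> inv y) = (x \<otimes> y \<otimes> inv x \<otimes> inv y) \<otimes> z"
      \<comment> \<open>The commutator of \<open>z\<close> with the chosen one lies in the term at
        \<open>Suc (Suc m)\<close>, which is the trivial term at \<open>n\<close>.\<close>
      by (rule comm) (use inS[OF z inS[OF xy(1,2)]] n m z xy y in auto)
  qed
qed

section \<open>Diffeomorphisms of the line\<close>

lemma Diff2_R_facts:
  assumes "f \<in> carrier Diff2_R"
  shows "bij f" and "C2_real f" and "0 < deriv f x"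
    and "(f has_real_derivative deriv f x) (at x)" and "continuous_on A f"
  using assms C2_real_DERIV
  by (auto simp: Diff2_R_def intro!: continuous_at_imp_continuous_on DERIV_isCont)

lemma Diff2_R_strict_mono:
  assumes "f \<in> carrier Diff2_R"
  shows "strict_mono f"
proof (rule strict_monoI)
  show "f x < f y" if "x < y" for x y
    by (rule DERIV_pos_imp_increasing[OF that])
      (intro exI conjI, rule Diff2_R_facts(4)[OF assms], rule Diff2_R_facts(3)[OF assms])
qed

lemma Diff2_R_second_deriv:
  assumes "f \<in> carrier Diff2_R"
  shows "(deriv f has_real_derivative deriv (deriv f) x) (at x)"
    and "continuous_on A (deriv (deriv f))" and "continuous_on A (deriv f)"
proof -
  have "deriv f C1_differentiable_on UNIV"
    using Diff2_R_facts(2)[OF assms] by (simp add: C2_real_def)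
  then obtain D where D: "\<And>x. (deriv f has_real_derivative D x) (at x)" "continuous_on UNIV D"
    unfolding C1_differentiable_on_def has_real_derivative_iff_has_vector_derivative by auto
  have eq: "deriv (deriv f) = D"
    by (rule ext, rule DERIV_imp_deriv, rule D(1))
  show "(deriv f has_real_derivative deriv (deriv f) x) (at x)"
    unfolding eq by (rule D(1))
  show "continuous_on A (deriv (deriv f))"
    unfolding eq by (rule continuous_on_subset[OF D(2)]) simp
  show "continuous_on A (deriv f)"
    by (intro continuous_at_imp_continuous_on ballI, rule DERIV_isCont, rule D(1))
qed

lemma Diff2_R_comp:
  assumes "f \<in> carrier Diff2_R" "g \<in> carrier Diff2_R"
  shows "f \<circ> g \<in> carrier Diff2_R"
  using monoid.m_closed[OF group.is_monoid[OF group_Diff2_R] assms] by (simp add: Diff2_R_def)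

lemma Diff2_R_inv:
  assumes "f \<in> carrier Diff2_R"
  shows "inv\<^bsub>Diff2_R\<^esub> f = inv_into UNIV f" and "inv_into UNIV f \<in> carrier Diff2_R"
proof -
  obtain g where g: "g \<in> carrier Diff2_R" "g \<circ> f = id"
    using group.l_inv_ex[OF group_Diff2_R assms] by (auto simp: Diff2_R_def)
  have "g = inv_into UNIV f"
    using g(2) Diff2_R_facts(1)[OF assms] by (metis bij_is_surj comp_id fun.map_comp id_comp surj_iff)
  with g show "inv_into UNIV f \<in> carrier Diff2_R" by simp
  then show "inv\<^bsub>Diff2_R\<^esub> f = inv_into UNIV f"
    using g \<open>g = inv_into UNIV f\<close> assms
    by (intro group.inv_equality[OF group_Diff2_R]) (simp_all add: Diff2_R_def)
qed

lemma Diff2_R_inv_apply [simp]: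
  assumes "f \<in> carrier Diff2_R"
  shows "f (inv_into UNIV f x) = x" and "inv_into UNIV f (f x) = x"
  using Diff2_R_facts(1)[OF assms] by (simp_all add: bij_is_surj bij_is_inj surj_f_inv_f)

lemma Diff2_R_funpow:
  assumes "f \<in> carrier Diff2_R"
  shows "f ^^ n \<in> carrier Diff2_R"
proof (induction n)
  case 0
  show ?case using monoid.one_closed[OF group.is_monoid[OF group_Diff2_R]]
    by (simp add: Diff2_R_def id_def)
next
  case (Suc n)
  then show ?case unfolding funpow.simps(2) by (rule Diff2_R_comp[OF assms])
qed

lemma deriv_funpow:
  assumes "f \<in> carrier Diff2_R"
  shows "deriv (f ^^ n) x = (\<Prod>i<n. deriv f ((f ^^ i) x))"
proof (induction n)
  case 0
  show ?case by (simp add: id_def)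
next
  case (Suc n)
  have "deriv (f \<circ> f ^^ n) x = deriv f ((f ^^ n) x) * deriv (f ^^ n) x"
    by (intro DERIV_imp_deriv deriv_compose_C2 Diff2_R_facts(2) Diff2_R_funpow assms)
  then show ?case using Suc by (simp add: mult.commute del: comp_apply)
qed

lemma funpow_commute:
  assumes "\<And>x. f (h x) = h (f x)"
  shows "(f ^^ n) (h x) = h ((f ^^ n) x)"
  by (induction n) (simp_all add: assms)

lemma inv_commute:
  assumes "f \<in> carrier Diff2_R" "\<And>x. f (h x) = h (f x)"
  shows "inv_into UNIV f (h x) = h (inv_into UNIV f x)"
  by (metis assms Diff2_R_inv_apply)

lemma inv_fixed:
  assumes "f \<in> carrier Diff2_R" "f p = p"
  shows "inv_into UNIV f p = p"
  using Diff2_R_inv_apply(2)[OF assms(1), of p] assms(2) by simp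

lemma funpow_fixed: "h x = x \<Longrightarrow> (h ^^ n) x = x"
  by (induction n) simp_all

lemma strict_mono_funpow:
  fixes f :: "'a::linorder \<Rightarrow> 'a"
  assumes "strict_mono f"
  shows "strict_mono (f ^^ n)"
  by (induction n) (use assms in \<open>auto simp: strict_mono_def\<close>)

section \<open>Kopell's lemma\<close>

text \<open>The second derivative enters here: the derivative of \<open>ln (deriv f x)\<close> is
  f''/f', which is continuous and hence bounded on a compact interval.\<close>

lemma log_deriv_Lipschitz:
  assumes f: "f \<in> carrier Diff2_R"
  obtains M where "0 \<le> M"
    "\<And>x y. x \<in> {a..b} \<Longrightarrow> y \<in> {a..b} \<Longrightarrow> \<bar>ln (deriv f x) - ln (deriv f y)\<bar> \<le> M * \<bar>x - y\<bar>"
proof -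
  let ?q = "\<lambda>x. deriv (deriv f) x / deriv f x"
  have "continuous_on {a..b} ?q"
    using Diff2_R_facts(3)[OF f]
    by (intro continuous_on_divide Diff2_R_second_deriv f) (auto simp: less_imp_neq[symmetric])
  then have "bounded (?q ` {a..b})"
    by (intro compact_imp_bounded compact_continuous_image) auto
  then obtain M where M: "0 < M" "\<And>x. x \<in> {a..b} \<Longrightarrow> \<bar>?q x\<bar> \<le> M"
    unfolding bounded_pos by auto
  have "((\<lambda>x. ln (deriv f x)) has_field_derivative ?q x) (at x within {a..b})" for x
  proof -
    have "((\<lambda>x. ln (deriv f x)) has_real_derivative 1 / deriv f x * deriv (deriv f) x) (at x)"
      by (rule DERIV_chain2[OF DERIV_ln_divide Diff2_R_second_deriv(1)])
        (use Diff2_R_facts(3)[OF f] f in auto)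
    then show ?thesis by (simp add: has_field_derivative_at_within)
  qed
  then have "\<bar>ln (deriv f x) - ln (deriv f y)\<bar> \<le> M * \<bar>x - y\<bar>" if "x \<in> {a..b}" "y \<in> {a..b}" for x y
    using field_differentiable_bound[of "{a..b}" "\<lambda>x. ln (deriv f x)" ?q M y x] M(2) that
    by (auto simp: abs_minus_commute)
  with M show thesis by (intro that[of M]) auto
qed

text \<open>The constant \<open>K\<close> serves all \<open>h\<close> at once, in particular all
  powers of a given one. From h = f^(-n) h f^n, the derivative of \<open>h\<close> at
  \<open>y\<close> is that of \<open>h\<close> at f^n y times the quotient of the derivatives of f^n
  at \<open>y\<close> and at h y. The quotient is at most \<open>exp (M * L)\<close>, and the other
  factor tends to the derivative of \<open>h\<close> at \<open>c\<close>, which is 1.\<close>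

lemma commuting_deriv_bound:
  assumes f: "f \<in> carrier Diff2_R" and uv: "u < v"
    and limu: "(\<lambda>n. (f ^^ n) u) \<longlonglongrightarrow> c" and limv: "(\<lambda>n. (f ^^ n) v) \<longlonglongrightarrow> c"
    and L: "\<And>n. (\<Sum>i<n. (f ^^ i) v - (f ^^ i) u) \<le> L"
  obtains K where
    "\<And>h y. h \<in> carrier Diff2_R \<Longrightarrow> (\<And>x. f (h x) = h (f x)) \<Longrightarrow> h u = u \<Longrightarrow> h v = v \<Longrightarrow>
      y \<in> {u..v} \<Longrightarrow> deriv h y \<le> K"
proof -
  have mono: "(f ^^ n) x \<le> (f ^^ n) y" if "x \<le> y" for n x y
    using strict_mono_funpow[OF Diff2_R_strict_mono[OF f]] that by (simp add: strict_mono_less_eq)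
  obtain B where B: "\<And>n. \<bar>(f ^^ n) u\<bar> \<le> B" "\<And>n. \<bar>(f ^^ n) v\<bar> \<le> B"
  proof -
    obtain B1 B2 where "\<And>n. \<bar>(f ^^ n) u\<bar> \<le> B1" "\<And>n. \<bar>(f ^^ n) v\<bar> \<le> B2"
      using convergent_imp_Bseq[OF convergentI[OF limu]] convergent_imp_Bseq[OF convergentI[OF limv]]
      unfolding Bseq_def by auto
    then show thesis
      by (intro that[of "max B1 B2"]) (simp_all add: le_max_iff_disj)
  qed
  obtain M where M: "0 \<le> M" and Lip: "\<And>x y. x \<in> {-B..B} \<Longrightarrow> y \<in> {-B..B} \<Longrightarrow>
      \<bar>ln (deriv f x) - ln (deriv f y)\<bar> \<le> M * \<bar>x - y\<bar>"
    using log_deriv_Lipschitz[OF f, of "-B" B] by metis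
  have pos: "0 < deriv (f ^^ n) x" for n x
    by (intro Diff2_R_facts Diff2_R_funpow f)
  \<comment> \<open>The chain rule turns \<open>ln\<close> of the quotient into a sum along two
    orbits. Its terms are at most \<open>M\<close> times the lengths of the images of [u, v], whose
    sum is bounded by \<open>L\<close>.\<close>
  have distort: "deriv (f ^^ n) y \<le> exp (M * L) * deriv (f ^^ n) z"
    if y: "y \<in> {u..v}" and z: "z \<in> {u..v}" for n y z
  proof -
    have "ln (deriv (f ^^ n) y) - ln (deriv (f ^^ n) z)
        = (\<Sum>i<n. ln (deriv f ((f ^^ i) y)) - ln (deriv f ((f ^^ i) z)))"
      using Diff2_R_facts(3)[OF f]
      by (simp add: deriv_funpow[OF f] ln_prod sum_subtractf less_imp_neq[symmetric])
    also have "\<dots> \<le> (\<Sum>i<n. M * ((f ^^ i) v - (f ^^ i) u))"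
    proof (rule sum_mono)
      fix i
      have b: "(f ^^ i) u \<le> (f ^^ i) y" "(f ^^ i) y \<le> (f ^^ i) v"
        "(f ^^ i) u \<le> (f ^^ i) z" "(f ^^ i) z \<le> (f ^^ i) v"
        using y z by (auto intro: mono)
      have "ln (deriv f ((f ^^ i) y)) - ln (deriv f ((f ^^ i) z)) \<le> M * \<bar>(f ^^ i) y - (f ^^ i) z\<bar>"
        using Lip[of "(f ^^ i) y" "(f ^^ i) z"] b B(1)[of i] B(2)[of i] by (simp add: abs_le_iff)
      also have "\<dots> \<le> M * ((f ^^ i) v - (f ^^ i) u)"
        using b M by (intro mult_left_mono) auto
      finally show "ln (deriv f ((f ^^ i) y)) - ln (deriv f ((f ^^ i) z)) \<le> \<dots>" .
    qed
    also have "\<dots> \<le> M * L"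
      using L[of n] M by (simp add: mult_left_mono flip: sum_distrib_left)
    finally have "ln (deriv (f ^^ n) y) \<le> ln (exp (M * L) * deriv (f ^^ n) z)"
      using pos[of n z] by (simp add: ln_mult)
    then show ?thesis using pos by (simp add: ln_le_cancel_iff)
  qed
  show thesis
  proof (rule that[of "exp (M * L)"])
    fix h y
    assume h: "h \<in> carrier Diff2_R" and comm: "\<And>x. f (h x) = h (f x)"
      and hu: "h u = u" and hv: "h v = v" and y: "y \<in> {u..v}"
    have cont: "isCont (deriv h) c"
      using Diff2_R_second_deriv(3)[OF h, of UNIV] by (simp add: continuous_on_eq_continuous_at)
    \<comment> \<open>By commutation \<open>h\<close> fixes both endpoints of the
      \<open>n\<close>-th image of [u, v], so the mean value theorem gives a point of derivative 1
      between them. These points converge to \<open>c\<close>.\<close>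
    have "\<exists>\<xi>. (f ^^ n) u < \<xi> \<and> \<xi> < (f ^^ n) v \<and> deriv h \<xi> = 1" for n
    proof -
      have lt: "(f ^^ n) u < (f ^^ n) v"
        using strict_mono_funpow[OF Diff2_R_strict_mono[OF f]] uv by (simp add: strict_mono_less)
      then obtain \<xi> where "(f ^^ n) u < \<xi>" "\<xi> < (f ^^ n) v"
        "h ((f ^^ n) v) - h ((f ^^ n) u) = ((f ^^ n) v - (f ^^ n) u) * deriv h \<xi>"
        using MVT2[OF lt, of h "deriv h"] Diff2_R_facts(4)[OF h] by blast
      then show ?thesis
        using lt funpow_commute[of f h n u, OF comm] funpow_commute[of f h n v, OF comm] hu hv by auto
    qed
    then obtain \<xi> where \<xi>: "\<And>n. (f ^^ n) u < \<xi> n" "\<And>n. \<xi> n < (f ^^ n) v" "\<And>n. deriv h (\<xi> n) = 1"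
      by metis
    have "\<xi> \<longlonglongrightarrow> c"
      by (rule tendsto_sandwich[OF _ _ limu limv]) (simp_all add: \<xi> less_imp_le)
    from isCont_tendsto_compose[OF cont this] have h1: "deriv h c = 1"
      by (simp add: \<xi>(3) LIMSEQ_const_iff)
    have "(\<lambda>n. (f ^^ n) y) \<longlonglongrightarrow> c"
      by (rule tendsto_sandwich[OF _ _ limu limv]) (use y in \<open>simp_all add: mono\<close>)
    from isCont_tendsto_compose[OF cont this] h1
    have lim: "(\<lambda>n. exp (M * L) * deriv h ((f ^^ n) y)) \<longlonglongrightarrow> exp (M * L) * 1"
      by (intro tendsto_mult tendsto_const) simp
    have "h u \<le> h y" "h y \<le> h v"
      using Diff2_R_strict_mono[OF h] y by (simp_all add: strict_mono_less_eq)
    then have hy: "h y \<in> {u..v}" by (simp add: hu hv)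
    have bound: "deriv h y \<le> exp (M * L) * deriv h ((f ^^ n) y)" for n
    proof -
      have "(f ^^ n) \<circ> h = h \<circ> (f ^^ n)"
        using funpow_commute[of f h, OF comm] by auto
      moreover have "((f ^^ n) \<circ> h has_real_derivative deriv (f ^^ n) (h y) * deriv h y) (at y)"
        "(h \<circ> (f ^^ n) has_real_derivative deriv h ((f ^^ n) y) * deriv (f ^^ n) y) (at y)"
        by (intro deriv_compose_C2 Diff2_R_facts Diff2_R_funpow f h)+
      ultimately have "deriv (f ^^ n) (h y) * deriv h y = deriv h ((f ^^ n) y) * deriv (f ^^ n) y"
        using DERIV_unique by metis
      also have "\<dots> \<le> deriv h ((f ^^ n) y) * (exp (M * L) * deriv (f ^^ n) (h y))"
        using Diff2_R_facts(3)[OF h] by (intro mult_left_mono distort y hy) (simp add: less_imp_le)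
      finally have "deriv (f ^^ n) (h y) * deriv h y
          \<le> deriv (f ^^ n) (h y) * (exp (M * L) * deriv h ((f ^^ n) y))"
        by (simp add: mult_ac)
      then show ?thesis using pos by (simp add: mult_le_cancel_left_pos)
    qed
    show "deriv h y \<le> exp (M * L)"
      using LIMSEQ_le_const[OF lim] bound by auto
  qed
qed

text \<open>All powers of $h$, negative ones included, are Lipschitz with the same constant. This forces
  $h$ to be the identity: $h^{-k}$ maps the points $h^k y$ and $h^{k+1} y$, whose distance tends to
  $0$, to $y$ and $h y$.\<close>

lemma Kopell_core:
  assumes f: "f \<in> carrier Diff2_R" and uv: "u < v"
    and limu: "(\<lambda>n. (f ^^ n) u) \<longlonglongrightarrow> c" and limv: "(\<lambda>n. (f ^^ n) v) \<longlonglongrightarrow> c"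
    and L: "\<And>n. (\<Sum>i<n. (f ^^ i) v - (f ^^ i) u) \<le> L"
    and h: "h \<in> carrier Diff2_R" and comm: "\<And>x. f (h x) = h (f x)"
    and hu: "h u = u" and hv: "h v = v" and y: "y \<in> {u..v}"
  shows "h y = y"
proof -
  obtain K where K: "\<And>h y. h \<in> carrier Diff2_R \<Longrightarrow> (\<And>x. f (h x) = h (f x)) \<Longrightarrow>
      h u = u \<Longrightarrow> h v = v \<Longrightarrow> y \<in> {u..v} \<Longrightarrow> deriv h y \<le> K"
    using commuting_deriv_bound[OF f uv limu limv L] by metis
  define g where "g = inv_into UNIV h"
  have g: "g \<in> carrier Diff2_R" "\<And>x. g (h x) = x" "g u = u" "g v = v"
    using h hu hv Diff2_R_inv(2) Diff2_R_inv_apply(2)[OF h] by (auto simp: g_def inv_fixed)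
  have gf: "f (g x) = g (f x)" for x
    using inv_commute[OF h, of f] comm by (simp add: g_def)
  have gh: "(g ^^ n) ((h ^^ n) x) = x" for n x
  proof (induction n)
    case (Suc n)
    have "(g ^^ Suc n) ((h ^^ Suc n) x) = (g ^^ n) (g (h ((h ^^ n) x)))"
      unfolding funpow_Suc_right[of n g] by simp
    then show ?case using Suc by (simp only: g(2))
  qed simp
  \<comment> \<open>The powers of \<open>g\<close> commute with \<open>f\<close> and fix
    \<open>u\<close> and \<open>v\<close>, so one \<open>K\<close> bounds the derivatives of them
    all.\<close>
  have deriv_g: "\<bar>deriv (g ^^ n) x\<bar> \<le> K" if "x \<in> {u..v}" for n x
  proof -
    have "f ((g ^^ n) z) = (g ^^ n) (f z)" for z
      using funpow_commute[of g f n z] gf by simp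
    then have "deriv (g ^^ n) x \<le> K"
      using that g by (intro K Diff2_R_funpow funpow_fixed)
    then show ?thesis
      using Diff2_R_facts(3)[OF Diff2_R_funpow[OF g(1)], of n x] by simp
  qed
  have Lip: "\<bar>(g ^^ n) x - (g ^^ n) z\<bar> \<le> K * \<bar>x - z\<bar>" if "x \<in> {u..v}" "z \<in> {u..v}" for n x z
  proof -
    have "(g ^^ n has_real_derivative deriv (g ^^ n) w) (at w within {u..v})" for w
      by (rule has_field_derivative_at_within[OF Diff2_R_facts(4)[OF Diff2_R_funpow[OF g(1)]]])
    then show ?thesis
      using field_differentiable_bound[of "{u..v}" "g ^^ n" "deriv (g ^^ n)" K z x] that deriv_g
      by (simp add: abs_minus_commute)
  qed
  have smh: "strict_mono (h ^^ n)" for n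
    by (intro strict_mono_funpow Diff2_R_strict_mono h)
  have in_uv: "(h ^^ n) y \<in> {u..v}" for n
    using smh[of n] y funpow_fixed[of h u n, OF hu] funpow_fixed[of h v n, OF hv]
    by (metis atLeastAtMost_iff strict_mono_less_eq)
  \<comment> \<open>A monotone bounded orbit converges, so the distance between its consecutive
    points tends to 0.\<close>
  have "monoseq (\<lambda>n. (h ^^ n) y)"
  proof (cases "y \<le> h y")
    case True
    then have "(h ^^ n) y \<le> (h ^^ Suc n) y" for n
      using smh[of n] by (simp add: funpow_swap1 strict_mono_less_eq)
    then show ?thesis by (simp add: monoseq_Suc)
  next
    case False
    then have "(h ^^ Suc n) y \<le> (h ^^ n) y" for n
      using smh[of n] by (simp add: funpow_swap1 strict_mono_less_eq)
    then show ?thesis by (simp add: monoseq_Suc)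
  qed
  moreover have "Bseq (\<lambda>n. (h ^^ n) y)"
  proof (rule BseqI')
    show "norm ((h ^^ n) y) \<le> max \<bar>u\<bar> \<bar>v\<bar>" for n
      using in_uv[of n] by auto
  qed
  ultimately obtain t where t: "(\<lambda>n. (h ^^ n) y) \<longlonglongrightarrow> t"
    using Bseq_monoseq_convergent convergent_def by blast
  have "(\<lambda>n. K * \<bar>(h ^^ n) y - (h ^^ Suc n) y\<bar>) \<longlonglongrightarrow> K * \<bar>t - t\<bar>"
    by (intro tendsto_intros t LIMSEQ_Suc[OF t])
  moreover have "\<bar>y - h y\<bar> \<le> K * \<bar>(h ^^ n) y - (h ^^ Suc n) y\<bar>" for n
    using Lip[OF in_uv[of n] in_uv[of "Suc n"], of n] gh[of n y] gh[of n "h y"]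
    by (simp add: funpow_swap1)
  ultimately have "\<bar>y - h y\<bar> \<le> K * \<bar>t - t\<bar>"
    using LIMSEQ_le_const by blast
  then show ?thesis by simp
qed

text \<open>The images of [a, f a] under the iterates of \<open>f\<close> are adjacent intervals.
  Iterating towards \<open>p\<close>, with \<open>f\<close> if a < p and with its inverse otherwise,
  keeps them on one side of \<open>p\<close>. Hence their lengths telescope to a bounded sum and
  both endpoints have the same limit, as \<open>Kopell_core\<close> requires.\<close>

lemma Kopell_increasing:
  assumes f: "f \<in> carrier Diff2_R" and h: "h \<in> carrier Diff2_R"
    and comm: "\<And>x. f (h x) = h (f x)" and p: "f p = p" and ha: "h a = a"
    and lt: "a < f a" and y: "y \<in> {a..f a}"
  shows "h y = y"
proof (cases "a < p")
  case True
  have smf: "strict_mono (f ^^ n)" for n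
    by (intro strict_mono_funpow Diff2_R_strict_mono f)
  have bound: "(f ^^ n) a \<le> p" for n
    using smf[of n] True funpow_fixed[of f p n, OF p] by (metis less_imp_le strict_mono_less_eq)
  have "incseq (\<lambda>n. (f ^^ n) a)"
    using smf lt by (intro incseq_SucI) (simp add: funpow_swap1 strict_mono_less_eq)
  then obtain c where c: "(\<lambda>n. (f ^^ n) a) \<longlonglongrightarrow> c"
    using incseq_convergent[of "\<lambda>n. (f ^^ n) a" p] bound by metis
  have c': "(\<lambda>n. (f ^^ n) (f a)) \<longlonglongrightarrow> c"
    using LIMSEQ_Suc[OF c] by (simp add: funpow_swap1)
  have "(\<Sum>i<n. (f ^^ i) (f a) - (f ^^ i) a) \<le> p - a" for n
    using sum_lessThan_telescope[of "\<lambda>i. (f ^^ i) a" n] bound[of n] by (simp add: funpow_swap1)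
  then show ?thesis
    by (rule Kopell_core[OF f lt c c' _ h comm ha _ y]) (metis comm ha)
next
  case False
  define g where "g = inv_into UNIV f"
  have g: "g \<in> carrier Diff2_R" "\<And>x. g (f x) = x" "g p = p"
    using f p Diff2_R_inv(2) Diff2_R_inv_apply(2)[OF f] by (auto simp: g_def inv_fixed)
  have gh: "g (h x) = h (g x)" for x
    using inv_commute[of f h, OF f comm] by (simp add: g_def)
  have smg: "strict_mono (g ^^ n)" for n
    by (intro strict_mono_funpow Diff2_R_strict_mono g)
  have bound: "p \<le> (g ^^ n) a" for n
    using smg[of n] False funpow_fixed[of g p n, OF g(3)] by (metis not_less strict_mono_less_eq)
  \<comment> \<open>Under the inverse, the left endpoint of each interval is the right endpoint of
    the next.\<close>
  have step: "(g ^^ Suc n) (f a) = (g ^^ n) a" for n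
    by (simp add: funpow_swap1 g(2))
  have bound': "p \<le> (g ^^ n) (f a)" for n
    using bound[of n] smg[of n] lt by (metis less_imp_le order_trans strict_mono_less_eq)
  have "decseq (\<lambda>n. (g ^^ n) (f a))"
    using smg lt by (intro decseq_SucI) (simp add: step strict_mono_less_eq del: funpow.simps)
  then obtain c where c: "(\<lambda>n. (g ^^ n) (f a)) \<longlonglongrightarrow> c"
    using decseq_convergent[of "\<lambda>n. (g ^^ n) (f a)" p] bound' by metis
  have c': "(\<lambda>n. (g ^^ n) a) \<longlonglongrightarrow> c"
    using LIMSEQ_Suc[OF c] by (simp add: step del: funpow.simps)
  have "(\<Sum>i<n. (g ^^ i) (f a) - (g ^^ i) a) \<le> f a - p" for n
    using sum_lessThan_telescope'[of "\<lambda>i. (g ^^ i) (f a)" n] bound'[of n]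
    by (simp add: step del: funpow.simps(2))
  then show ?thesis
    by (rule Kopell_core[OF g(1) lt c' c _ h gh ha _ y]) (metis comm ha)
qed

lemma Kopell:
  assumes f: "f \<in> carrier Diff2_R" and h: "h \<in> carrier Diff2_R"
    and comm: "\<And>x. f (h x) = h (f x)" and p: "f p = p" and ha: "h a = a"
    and y: "y \<in> closed_segment a (f a)"
  shows "h y = y"
proof (cases "a < f a")
  case True
  then show ?thesis
    using Kopell_increasing[OF f h comm p ha] y by (auto simp: closed_segment_eq_real_ivl)
next
  case False
  have "inv_into UNIV f p = p" by (rule inv_fixed[OF f p])
  moreover have "h (f a) = f a" using comm ha by metis
  \<comment> \<open>If f a < a, the inverse of \<open>f\<close> moves the point f a, also fixed by
    \<open>h\<close>, up to \<open>a\<close> over the same segment. If f a = a, the segment is a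
    single point.\<close>
  ultimately show ?thesis
    using Kopell_increasing[of "inv_into UNIV f" h p "f a" y] False y ha f h inv_commute[of f h, OF f comm] Diff2_R_inv(2)
    by (cases "f a = a") (auto simp: closed_segment_eq_real_ivl)
qed

section \<open>Heisenberg relations on the line\<close>

text \<open>As \<open>h\<close> commutes with \<open>f\<close> and \<open>g\<close>, each exchange
  of one \<open>f\<close> with one \<open>g\<close> contributes one factor \<open>h\<close>; moving
  \<open>p\<close> copies past \<open>q\<close> takes \<open>p * q\<close> exchanges.\<close>

lemma funpow_heisenberg:
  assumes rel: "\<And>x. f (g x) = h (g (f x))"
    and fh: "\<And>x. f (h x) = h (f x)" and gh: "\<And>x. g (h x) = h (g x)"
  shows "(f ^^ p) ((g ^^ q) x) = (h ^^ (p * q)) ((g ^^ q) ((f ^^ p) x))"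
proof -
  have gp: "(g ^^ q) ((h ^^ k) x) = (h ^^ k) ((g ^^ q) x)" for q k x
    using funpow_commute[of g "h ^^ k"] funpow_commute[of h g k] gh by metis
  have fp: "f ((h ^^ k) x) = (h ^^ k) (f x)" for k x
    using funpow_commute[of h f k] fh by metis
  have one: "f ((g ^^ q) x) = (h ^^ q) ((g ^^ q) (f x))" for x
  proof (induction q)
    case (Suc q)
    have "f ((g ^^ Suc q) x) = h (g (f ((g ^^ q) x)))" by (simp add: rel)
    also have "\<dots> = h (g ((h ^^ q) ((g ^^ q) (f x))))" by (simp add: Suc)
    also have "\<dots> = (h ^^ Suc q) ((g ^^ Suc q) (f x))" using gp[of 1] by simp
    finally show ?case .
  qed simp
  show ?thesis
  proof (induction p)
    case (Suc p)
    have "(f ^^ Suc p) ((g ^^ q) x) = f ((h ^^ (p * q)) ((g ^^ q) ((f ^^ p) x)))"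
      by (simp add: Suc)
    also have "\<dots> = (h ^^ (p * q + q)) ((g ^^ q) ((f ^^ Suc p) x))"
      by (simp add: fp one funpow_add)
    finally show ?case by (simp add: add.commute)
  qed simp
qed

text \<open>Since \<open>f\<close> commutes with \<open>h\<close>, the bound at \<open>x\<close>
  carries over to every point of the orbit and the exponents add up: displacement grows at most
  linearly in \<open>p\<close>. The lower bound h^(-m) x \<le> f x is written with positive powers
  of \<open>h\<close> only, which avoids inverses.\<close>

lemma funpow_displacement:
  fixes f h :: "'a::linorder \<Rightarrow> 'a"
  assumes f: "strict_mono f" and h: "strict_mono h" and fh: "\<And>x. f (h x) = h (f x)"
    and up: "f x \<le> (h ^^ m) x" and lo: "x \<le> (h ^^ m) (f x)"
  shows "(f ^^ p) x \<le> (h ^^ (m * p)) x" and "x \<le> (h ^^ (m * p)) ((f ^^ p) x)"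
proof -
  have fhk: "(f ^^ p) ((h ^^ k) z) = (h ^^ k) ((f ^^ p) z)" for p k z
    using funpow_commute[of f "h ^^ k"] funpow_commute[of h f k] fh by metis
  have le: "(h ^^ k) z \<le> (h ^^ k) w" "(f ^^ k) z \<le> (f ^^ k) w" if "z \<le> w" for k z w
    using strict_mono_funpow[OF h] strict_mono_funpow[OF f] that by (simp_all add: strict_mono_less_eq)
  show "(f ^^ p) x \<le> (h ^^ (m * p)) x"
  proof (induction p)
    case (Suc p)
    have "(f ^^ Suc p) x = (f ^^ p) (f x)" by (simp add: funpow_swap1)
    also have "\<dots> \<le> (h ^^ m) ((f ^^ p) x)" using le(2)[OF up] by (simp add: fhk)
    also have "\<dots> \<le> (h ^^ m) ((h ^^ (m * p)) x)" using Suc by (rule le(1))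
    finally show ?case by (simp add: funpow_add)
  qed simp
  show "x \<le> (h ^^ (m * p)) ((f ^^ p) x)"
  proof (induction p)
    case (Suc p)
    note Suc
    also have "(h ^^ (m * p)) ((f ^^ p) x) \<le> (h ^^ (m * p)) ((f ^^ p) ((h ^^ m) (f x)))"
      using lo by (intro le)
    also have "\<dots> = (h ^^ (m * p + m)) ((f ^^ Suc p) x)"
      by (simp add: fhk funpow_add funpow_swap1)
    finally show ?case by (simp add: add.commute)
  qed simp
qed

text \<open>The linear displacement of f^p and g^p contradicts the quadratic exponent in
  \<open>funpow_heisenberg\<close> once \<open>p\<close> is large.\<close>

lemma no_heisenberg_displacement:
  fixes f g h :: "'a::linorder \<Rightarrow> 'a"
  assumes sm: "strict_mono f" "strict_mono g" "strict_mono h"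
    and rel: "\<And>x. f (g x) = h (g (f x))"
    and fh: "\<And>x. f (h x) = h (f x)" and gh: "\<And>x. g (h x) = h (g x)"
    and hx: "x < h x"
    and f: "f x \<le> (h ^^ m) x" "x \<le> (h ^^ m) (f x)"
    and g: "g x \<le> (h ^^ m) x" "x \<le> (h ^^ m) (g x)"
  shows False
proof -
  \<comment> \<open>This makes p^2 exceed 4mp, the total displacement bound: mp for each of the four
    powers f^p, g^p on the two sides of the relation.\<close>
  define p where "p = 4 * m + 1"
  have le: "(h ^^ k) z \<le> (h ^^ k) w" "(f ^^ k) z \<le> (f ^^ k) w" "(g ^^ k) z \<le> (g ^^ k) w"
    if "z \<le> w" for k z w
    using strict_mono_funpow[OF sm(1)] strict_mono_funpow[OF sm(2)] strict_mono_funpow[OF sm(3)] that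
    by (simp_all add: strict_mono_less_eq)
  have fhk: "(f ^^ p) ((h ^^ k) z) = (h ^^ k) ((f ^^ p) z)" for p k z
    using funpow_commute[of f "h ^^ k"] funpow_commute[of h f k] fh by metis
  have ghk: "(g ^^ p) ((h ^^ k) z) = (h ^^ k) ((g ^^ p) z)" for p k z
    using funpow_commute[of g "h ^^ k"] funpow_commute[of h g k] gh by metis
  note F = funpow_displacement[OF sm(1,3) fh f, of p] and G = funpow_displacement[OF sm(2,3) gh g, of p]
  let ?s = "m * p"
  have "(f ^^ p) ((g ^^ p) x) \<le> (h ^^ (?s + ?s)) x"
  proof -
    have "(f ^^ p) ((g ^^ p) x) \<le> (h ^^ ?s) ((f ^^ p) x)"
      using le(2)[OF G(1), of p] by (simp add: fhk)
    also have "\<dots> \<le> (h ^^ ?s) ((h ^^ ?s) x)" using F(1) by (rule le(1))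
    finally show ?thesis by (simp add: funpow_add)
  qed
  moreover have "x \<le> (h ^^ (?s + ?s)) ((g ^^ p) ((f ^^ p) x))"
  proof -
    have "x \<le> (h ^^ ?s) ((g ^^ p) x)" by (rule G)
    also have "\<dots> \<le> (h ^^ ?s) ((g ^^ p) ((h ^^ ?s) ((f ^^ p) x)))" by (intro le F)
    finally show ?thesis by (simp add: ghk funpow_add)
  qed
  ultimately have "(h ^^ (p * p)) x \<le> (h ^^ (?s + ?s)) ((h ^^ (?s + ?s)) x)"
  proof -
    assume a: "(f ^^ p) ((g ^^ p) x) \<le> (h ^^ (?s + ?s)) x"
      and b: "x \<le> (h ^^ (?s + ?s)) ((g ^^ p) ((f ^^ p) x))"
    have "(h ^^ (p * p)) x \<le> (h ^^ (p * p)) ((h ^^ (?s + ?s)) ((g ^^ p) ((f ^^ p) x)))"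
      using b by (rule le(1))
    also have "\<dots> = (h ^^ (?s + ?s)) ((h ^^ (p * p)) ((g ^^ p) ((f ^^ p) x)))"
      by (metis add.commute comp_apply funpow_add)
    also have "\<dots> = (h ^^ (?s + ?s)) ((f ^^ p) ((g ^^ p) x))"
      using funpow_heisenberg[of f g h p p x, OF rel fh gh] by simp
    also have "\<dots> \<le> (h ^^ (?s + ?s)) ((h ^^ (?s + ?s)) x)" using a by (rule le(1))
    finally show ?thesis .
  qed
  then have "(h ^^ (p * p)) x \<le> (h ^^ ((?s + ?s) + (?s + ?s))) x"
    by (simp only: funpow_add comp_apply)
  \<comment> \<open>Since \<open>h\<close> moves \<open>x\<close> to the right, comparing iterates
    at \<open>x\<close> amounts to comparing exponents.\<close>
  moreover have "strict_mono (\<lambda>n. (h ^^ n) x)"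
    using strict_mono_funpow[OF sm(3)] hx
    by (intro strict_mono_Suc_iff[THEN iffD2]) (simp add: funpow_swap1 strict_mono_less)
  ultimately have "p * p \<le> (?s + ?s) + (?s + ?s)"
    using strict_mono_less_eq[of "\<lambda>n. (h ^^ n) x"] by blast
  then show False by (simp add: p_def algebra_simps)
qed

section \<open>Displacement on intervals without fixed points\<close>

lemma iterates_pass:
  fixes h :: "real \<Rightarrow> real"
  assumes h: "strict_mono h" "continuous_on UNIV h" and x: "x < h x"
    and nofix: "\<And>t. t \<in> {x..y} \<Longrightarrow> h t \<noteq> t"
  shows "\<exists>m. \<forall>n\<ge>m. y \<le> (h ^^ n) x"
proof (rule ccontr)
  assume neg: "\<not> ?thesis"
  have inc: "incseq (\<lambda>n. (h ^^ n) x)"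
    using strict_mono_funpow[OF h(1)] x
    by (intro incseq_SucI) (simp add: funpow_swap1 strict_mono_less_eq)
  have lt: "(h ^^ n) x \<le> y" for n
  proof (rule ccontr)
    assume "\<not> (h ^^ n) x \<le> y"
    then have "\<forall>k\<ge>n. y \<le> (h ^^ k) x"
      using incseqD[OF inc] by (meson less_imp_le not_le order_trans)
    with neg show False by blast
  qed
  \<comment> \<open>A bounded increasing orbit converges, by continuity to a fixed point of
    \<open>h\<close> in [x, y].\<close>
  obtain t where t: "(\<lambda>n. (h ^^ n) x) \<longlonglongrightarrow> t" "\<And>n. (h ^^ n) x \<le> t"
    using incseq_convergent[OF inc, of y] lt by metis
  have "(\<lambda>n. h ((h ^^ n) x)) \<longlonglongrightarrow> h t"
    using h(2) t(1) by (intro isCont_tendsto_compose[of t h]) (simp_all add: continuous_on_eq_continuous_at)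
  moreover have "(\<lambda>n. h ((h ^^ n) x)) \<longlonglongrightarrow> t"
    using LIMSEQ_Suc[OF t(1)] by simp
  ultimately have "h t = t" by (rule LIMSEQ_unique)
  moreover have "t \<in> {x..y}"
    using t(2)[of 0] LIMSEQ_le_const2[OF t(1)] lt by auto
  ultimately show False using nofix by blast
qed

text \<open>By the intermediate value theorem, \<open>h t - t\<close> keeps its sign on a segment
  where it has no zero.\<close>

lemma moves_right_between:
  fixes h :: "real \<Rightarrow> real"
  assumes cont: "continuous_on UNIV h" and x: "x < h x"
    and nofix: "\<And>t. t \<in> closed_segment x y \<Longrightarrow> h t \<noteq> t"
  shows "y < h y"
proof (rule ccontr)
  assume "\<not> y < h y"
  moreover have "continuous_on (closed_segment x y) (\<lambda>t. h t - t)"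
    by (intro continuous_intros continuous_on_subset[OF cont]) simp
  moreover have "connected (closed_segment x y)" by simp
  ultimately have "\<exists>t\<in>closed_segment x y. h t - t = 0"
    using x connectedD_interval[OF connected_continuous_image, of "closed_segment x y" "\<lambda>t. h t - t"
        "h y - y" "h x - x" 0] by force
  then show False using nofix by force
qed

text \<open>Both points move right under \<open>h\<close>, so the iterates of each pass the other.
  This supplies the bounds for \<open>no_heisenberg_displacement\<close>; that they hold for all
  large \<open>n\<close> allows one exponent for both \<open>f\<close> and \<open>g\<close>.\<close>

lemma bounded_displacement:
  fixes h :: "real \<Rightarrow> real"
  assumes h: "strict_mono h" "continuous_on UNIV h" and x: "x < h x"
    and nofix: "\<And>t. t \<in> closed_segment x y \<Longrightarrow> h t \<noteq> t"
  shows "\<exists>m. \<forall>n\<ge>m. y \<le> (h ^^ n) x \<and> x \<le> (h ^^ n) y"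
proof -
  have "y < h y" by (rule moves_right_between[OF h(2) x nofix])
  \<comment> \<open>Unless x = y, one of these intervals is empty, and in that direction there is no
    fixed point to exclude.\<close>
  moreover have "{x..y} \<subseteq> closed_segment x y" "{y..x} \<subseteq> closed_segment x y"
    by (auto simp: closed_segment_eq_real_ivl)
  ultimately obtain m m' where "\<forall>n\<ge>m. y \<le> (h ^^ n) x" "\<forall>n\<ge>m'. x \<le> (h ^^ n) y"
    using iterates_pass[OF h x, of y] iterates_pass[OF h, of y x] nofix by (meson subsetD)
  then show ?thesis by (intro exI[of _ "max m m'"]) auto
qed

lemma no_heisenberg_right:
  assumes sm: "strict_mono f" "strict_mono g" "strict_mono h" and cont: "continuous_on UNIV h"
    and rel: "\<And>x. f (g x) = h (g (f x))"
    and fh: "\<And>x. f (h x) = h (f x)" and gh: "\<And>x. g (h x) = h (g x)"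
    and x: "(x::real) < h x"
    and nofix: "\<And>t. t \<in> closed_segment x (f x) \<Longrightarrow> h t \<noteq> t" "\<And>t. t \<in> closed_segment x (g x) \<Longrightarrow> h t \<noteq> t"
  shows False
proof -
  obtain m m' where "\<forall>n\<ge>m. f x \<le> (h ^^ n) x \<and> x \<le> (h ^^ n) (f x)"
    "\<forall>n\<ge>m'. g x \<le> (h ^^ n) x \<and> x \<le> (h ^^ n) (g x)"
    using bounded_displacement[OF sm(3) cont x nofix(1)] bounded_displacement[OF sm(3) cont x nofix(2)]
    by blast
  then show False
    using no_heisenberg_displacement[OF sm rel fh gh x, of "max m m'"] by auto
qed

lemma no_heisenberg:
  assumes f: "f \<in> carrier Diff2_R" and g: "g \<in> carrier Diff2_R" and h: "h \<in> carrier Diff2_R"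
    and rel: "\<And>x. f (g x) = h (g (f x))"
    and fh: "\<And>x. f (h x) = h (f x)" and gh: "\<And>x. g (h x) = h (g x)"
    and nofix: "\<And>t. t \<in> closed_segment x (f x) \<Longrightarrow> h t \<noteq> t" "\<And>t. t \<in> closed_segment x (g x) \<Longrightarrow> h t \<noteq> t"
  shows False
proof -
  note sm = Diff2_R_strict_mono[OF f] Diff2_R_strict_mono[OF g] Diff2_R_strict_mono[OF h]
  have "h x \<noteq> x" using nofix(1) by auto
  then consider "x < h x" | "h x < x" by linarith
  then show False
  proof cases
    case 1
    show False
      by (rule no_heisenberg_right[OF sm Diff2_R_facts(5)[OF h] rel fh gh 1 nofix])
  next
    case 2
    define k where "k = inv_into UNIV h"
    have k: "k \<in> carrier Diff2_R" and kh: "\<And>x. k (h x) = x" "\<And>x. h (k x) = x"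
      using h Diff2_R_inv(2) by (auto simp: k_def)
    have fk: "f (k x) = k (f x)" "g (k x) = k (g x)" for x
      using inv_commute[OF h, of f] inv_commute[OF h, of g] fh gh by (auto simp: k_def)
    \<comment> \<open>If \<open>h\<close> moves \<open>x\<close> to the left, its inverse
      \<open>k\<close> moves it to the right, and the relation holds for \<open>k\<close> with
      \<open>f\<close> and \<open>g\<close> exchanged.\<close>
    have "g (f x) = k (f (g x))" for x by (simp add: rel kh)
    moreover have "x < k x"
      using 2 Diff2_R_strict_mono[OF h] by (metis kh(2) strict_mono_less)
    moreover have "h t = t" if "k t = t" for t using kh(2)[of t] that by simp
    ultimately show False
      using no_heisenberg_right[OF sm(2,1) Diff2_R_strict_mono[OF k] Diff2_R_facts(5)[OF k] _ fk(2,1)] nofix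
      by meson
  qed
qed

section \<open>Endpoints of intervals without fixed points\<close>

lemma adjacent_fixed_point:
  fixes h :: "real \<Rightarrow> real"
  assumes cont: "continuous_on UNIV h" and p: "h p = p" and y: "h y \<noteq> y"
  obtains a where "h a = a" "\<And>t. t \<in> closed_segment a y \<Longrightarrow> h t = t \<Longrightarrow> t = a"
proof -
  \<comment> \<open>\<open>a\<close> will be a point of this closed nonempty set nearest to
    \<open>y\<close>; it may lie on either side of \<open>y\<close>.\<close>
  let ?S = "closed_segment p y \<inter> {t. h t = t}"
  have "closed {t. h t = t}"
    by (rule closed_Collect_eq[OF cont continuous_on_id])
  then have "closed ?S" by (intro closed_Int) simp_all
  moreover have "?S \<noteq> {}" using p by auto
  ultimately obtain a where a: "a \<in> ?S" "\<And>t. t \<in> ?S \<Longrightarrow> dist y a \<le> dist y t"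
    by (rule distance_attains_inf) blast
  show thesis
  proof (rule that[of a])
    fix t assume t: "t \<in> closed_segment a y" "h t = t"
    have "closed_segment a y \<subseteq> closed_segment p y"
      using a(1) by (intro closed_segment_subset convex_closed_segment) auto
    with t have "t \<in> ?S" by blast
    then have "dist y a \<le> dist y t" by (rule a(2))
    then show "t = a"
      using t(1) by (cases "a \<le> y") (simp_all add: closed_segment_eq_real_ivl dist_real_def)
  qed (use a in auto)
qed

text \<open>If \<open>f\<close> moved \<open>a\<close>, then \<open>f\<close> or its inverse would
  move it towards \<open>y\<close>. Kopell's lemma would make \<open>h\<close> the identity from
  \<open>a\<close> to that image, giving a fixed point of \<open>h\<close> other than
  \<open>a\<close> on the segment from \<open>a\<close> to \<open>y\<close>.\<close>

lemma fixes_adjacent: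
  assumes f: "f \<in> carrier Diff2_R" and h: "h \<in> carrier Diff2_R"
    and comm: "\<And>x. f (h x) = h (f x)" and p: "f p = p"
    and a: "h a = a" and adj: "\<And>t. t \<in> closed_segment a y \<Longrightarrow> h t = t \<Longrightarrow> t = a" and y: "y \<noteq> a"
  shows "f a = a"
proof (rule ccontr)
  assume ne: "f a \<noteq> a"
  have key: False if w: "w \<in> carrier Diff2_R" "\<And>x. w (h x) = h (w x)" "w p = p"
    and side: "(a < w a \<and> a < y) \<or> (w a < a \<and> y < a)" for w
  proof -
    \<comment> \<open>\<open>t\<close> is whichever of w a and \<open>y\<close> is nearer to
      \<open>a\<close>, so it lies on both segments.\<close>
    define t where "t = (if a < y then min (w a) y else max (w a) y)"
    have t: "t \<in> closed_segment a (w a)" "t \<in> closed_segment a y" "t \<noteq> a"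
      using side by (auto simp: t_def closed_segment_eq_real_ivl)
    have "h t = t" by (rule Kopell[OF w(1) h w(2,3) a t(1)])
    then show False using adj[OF t(2)] t(3) by simp
  qed
  have "f a < a \<longleftrightarrow> a < inv_into UNIV f a" "a < f a \<longleftrightarrow> inv_into UNIV f a < a"
    using strict_mono_less[OF Diff2_R_strict_mono[OF f], of a "inv_into UNIV f a"]
      strict_mono_less[OF Diff2_R_strict_mono[OF f], of "inv_into UNIV f a" a] f by simp_all
  then have "(a < f a \<and> a < y) \<or> (f a < a \<and> y < a) \<or>
      (a < inv_into UNIV f a \<and> a < y) \<or> (inv_into UNIV f a < a \<and> y < a)"
    using ne y by linarith
  then show False
    using key[OF f comm p] key[OF Diff2_R_inv(2)[OF f] inv_commute[of f h, OF f comm] inv_fixed[OF f p]]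
    by blast
qed

text \<open>\<open>f\<close> fixes \<open>a\<close> and preserves the fixed point set of
  \<open>h\<close>. A fixed point of \<open>h\<close> between \<open>y\<close> and f y would lie on
  the segment from \<open>a\<close> to \<open>y\<close> if \<open>f\<close> moves \<open>y\<close>
  towards \<open>a\<close>; otherwise its preimage under \<open>f\<close> would.\<close>

lemma no_fixed_point_towards_image:
  assumes f: "f \<in> carrier Diff2_R" and comm: "\<And>x. f (h x) = h (f x)" and fa: "f a = a"
    and adj: "\<And>t. t \<in> closed_segment a y \<Longrightarrow> h t = t \<Longrightarrow> t = a" and y: "y \<noteq> a"
    and t: "t \<in> closed_segment y (f y)"
  shows "h t \<noteq> t"
proof
  assume ht: "h t = t"
  define s where "s = inv_into UNIV f t"
  have fs: "f s = t" by (simp add: s_def f)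
  have hs: "h s = s"
    using inv_commute[of f h t, OF f comm] ht by (simp add: s_def)
  have "x < z \<longleftrightarrow> f x < f z" for x z
    using Diff2_R_strict_mono[OF f] by (simp add: strict_mono_less)
  from this[of s y] this[of y s] this[of a s] this[of s a] this[of a y] this[of y a]
  have "(t \<in> closed_segment a y \<or> s \<in> closed_segment a y) \<and> t \<noteq> a \<and> s \<noteq> a"
    using t y fs fa unfolding closed_segment_eq_real_ivl
    by (smt (verit) atLeastAtMost_iff)
  with adj ht hs show False by blast
qed

theorem theorem1p5:
  fixes N :: "(real \<Rightarrow> real) set"
  assumes "subgroup N Diff2_R"
    and "nilpotent_group (Diff2_R\<lparr>carrier := N\<rparr>)"
    and "\<forall>f \<in> N. \<exists>x. f x = x"
  shows "comm_group (Diff2_R\<lparr>carrier := N\<rparr>)"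
proof (rule ccontr)
  let ?G = "Diff2_R\<lparr>carrier := N\<rparr>"
  assume nc: "\<not> comm_group ?G"
  have G: "group ?G"
    using assms(2) by (simp add: nilpotent_group_def)
  have sub: "f \<in> carrier Diff2_R" if "f \<in> N" for f
    using that subgroup.subset[OF assms(1)] by blast
  obtain f g where f: "f \<in> N" and g: "g \<in> N"
    and ne: "f \<otimes>\<^bsub>?G\<^esub> g \<otimes>\<^bsub>?G\<^esub> inv\<^bsub>?G\<^esub> f \<otimes>\<^bsub>?G\<^esub> inv\<^bsub>?G\<^esub> g \<noteq> \<one>\<^bsub>?G\<^esub>"
    and central: "\<And>z. z \<in> N \<Longrightarrow>
      z \<otimes>\<^bsub>?G\<^esub> (f \<otimes>\<^bsub>?G\<^esub> g \<otimes>\<^bsub>?G\<^esub> inv\<^bsub>?G\<^esub> f \<otimes>\<^bsub>?G\<^esub> inv\<^bsub>?G\<^esub> g)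
      = (f \<otimes>\<^bsub>?G\<^esub> g \<otimes>\<^bsub>?G\<^esub> inv\<^bsub>?G\<^esub> f \<otimes>\<^bsub>?G\<^esub> inv\<^bsub>?G\<^esub> g) \<otimes>\<^bsub>?G\<^esub> z"
    by (rule group.nilpotent_central_commutator[OF G assms(2) nc]) simp
  have inv_eq: "inv\<^bsub>?G\<^esub> u = inv_into UNIV u" if "u \<in> N" for u
    using group.m_inv_consistent[OF group_Diff2_R assms(1) that] Diff2_R_inv(1)[OF sub[OF that]] by simp
  define h where "h = f \<circ> g \<circ> inv_into UNIV f \<circ> inv_into UNIV g"
  have h_eq: "f \<otimes>\<^bsub>?G\<^esub> g \<otimes>\<^bsub>?G\<^esub> inv\<^bsub>?G\<^esub> f \<otimes>\<^bsub>?G\<^esub> inv\<^bsub>?G\<^esub> g = h"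
    by (simp only: inv_eq f g) (simp add: h_def Diff2_R_def)
  have "f \<otimes>\<^bsub>?G\<^esub> g \<otimes>\<^bsub>?G\<^esub> inv\<^bsub>?G\<^esub> f \<otimes>\<^bsub>?G\<^esub> inv\<^bsub>?G\<^esub> g \<in> carrier ?G"
    using f g by (intro monoid.m_closed[OF group.is_monoid[OF G]] group.inv_closed[OF G]) simp_all
  then have h: "h \<in> N" unfolding h_eq by simp
  have comm: "z (h x) = h (z x)" if "z \<in> N" for z x
    using fun_cong[OF central[OF that], of x] unfolding h_eq by (simp add: Diff2_R_def)
  have "h \<noteq> id" using ne unfolding h_eq by (simp add: Diff2_R_def)
  then obtain y where hy: "h y \<noteq> y" by (metis eq_id_iff)
  note D = sub[OF f] sub[OF g] sub[OF h]
  \<comment> \<open>As an element of \<open>N\<close>, the commutator \<open>h\<close> has a fixed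
    point; \<open>a\<close> is then an end of the interval without fixed points that contains
    \<open>y\<close>.\<close>
  obtain p where hp: "h p = p" using bspec[OF assms(3) h] by (rule exE)
  obtain a where a: "h a = a" and adj: "\<And>t. t \<in> closed_segment a y \<Longrightarrow> h t = t \<Longrightarrow> t = a"
    using hp by (rule adjacent_fixed_point[OF Diff2_R_facts(5)[OF D(3)] _ hy]) blast
  have ya: "y \<noteq> a" using a hy by blast
  \<comment> \<open>This will be applied to \<open>f\<close> and \<open>g\<close>. Every element of
    \<open>N\<close> commutes with \<open>h\<close> and has a fixed point, as Kopell's lemma
    demands.\<close>
  have nofix: "h t \<noteq> t" if u: "u \<in> N" and t: "t \<in> closed_segment y (u y)" for u t
  proof -
    obtain p where p: "u p = p" using bspec[OF assms(3) u] by (rule exE)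
    have "u a = a"
      by (rule fixes_adjacent[OF sub[OF u] D(3) comm[OF u] p a adj ya])
    then show ?thesis
      by (rule no_fixed_point_towards_image[of u h, OF sub[OF u] comm[OF u] _ adj ya t])
  qed
  \<comment> \<open>The goal left over is the relation \<open>f (g x) = h (g (f x))\<close>, which
    follows from the definition of \<open>h\<close> as a commutator.\<close>
  show False
    by (rule no_heisenberg[OF D _ comm[OF f] comm[OF g] nofix[OF f] nofix[OF g]])
      (simp_all add: h_def D)
qed

end
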